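(* Let $G$ be a connected graph. (i) If $G$ has no simplicial vertex and $H$ is a connected graph with no simplicial vertex, then $\mathrm{gp}_{\rm d}(G\circ H)=0$. (ii) If $n\ge 1$, then $\mathrm{gp}_{\rm d}(G\circ K_n)=n\cdot\mathrm{gp}_{\rm d}(G)$.
   Context: All graphs are finite and simple, and (as a standing assumption of the paper) connected. For $X\subseteq V(G)$, two vertices $u,v$ are $X$-positionable if no shortest $u,v$-path has an internal vertex in $X$. $X$ is a dual general position set if every two vertices of $X$ are $X$-positionable and every two vertices of $V(G)\setminus X$ are $X$-positionable; $\mathrm{gp}_{\rm d}(G)$ is the maximum cardinality of such a set (the empty set is allowed, so the value can be $0$). A vertex is simplicial if its neighbourhood induces a complete subgraph. The lexicographic product $G\circ H$ has vertex set $V(G)\times V(H)$, with $(g,h)$ and $(g',h')$ adjacent iff either $gg'\in E(G)$, or $g=g'$ and $hh'\in E(H)$. $K_n$ is the complete graph on $n$ vertices. *)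

theory Defs
  imports "Graph_Theory.Graph_Theory"
begin

text \<open>
  Finite simple graphs are rendered by the locale \<^locale>\<open>pair_graph\<close>: a finite vertex set with a
  symmetric irreflexive set of arcs. Connectedness is \<^const>\<open>Digraph_Component.connected\<close>, which
  requires the vertex set to be nonempty.
\<close>

definition neighbourhood :: "'a pair_pre_digraph \<Rightarrow> 'a \<Rightarrow> 'a set" where
  "neighbourhood G v = {u. (v, u) \<in> parcs G}"

text \<open>An isolated vertex is simplicial: its neighbourhood induces the null graph, which is
  \<open>K\<^sub>0\<close> for \<^const>\<open>complete_digraph\<close>.\<close>

definition simplicial :: "'a pair_pre_digraph \<Rightarrow> 'a \<Rightarrow> bool" where
  "simplicial G v \<longleftrightarrow> v \<in> pverts G \<and>
     complete_digraph (card (neighbourhood G v))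
       (induce_subgraph (with_proj G) (neighbourhood G v))"

definition path_between :: "'a pair_pre_digraph \<Rightarrow> 'a \<Rightarrow> 'a vwalk \<Rightarrow> 'a \<Rightarrow> bool" where
  "path_between G u p v \<longleftrightarrow> vpath p (with_proj G) \<and> hd p = u \<and> last p = v"

definition shortest_path :: "'a pair_pre_digraph \<Rightarrow> 'a \<Rightarrow> 'a vwalk \<Rightarrow> 'a \<Rightarrow> bool" where
  "shortest_path G u p v \<longleftrightarrow> path_between G u p v \<and>
     (\<forall>q. path_between G u q v \<longrightarrow> vwalk_length p \<le> vwalk_length q)"

definition positionable :: "'a pair_pre_digraph \<Rightarrow> 'a set \<Rightarrow> 'a \<Rightarrow> 'a \<Rightarrow> bool" where
  "positionable G X u v \<longleftrightarrow>
     \<not> (\<exists>p. shortest_path G u p v \<and> (\<exists>x \<in> set p - {u, v}. x \<in> X))"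

definition dual_gp_set :: "'a pair_pre_digraph \<Rightarrow> 'a set \<Rightarrow> bool" where
  "dual_gp_set G X \<longleftrightarrow> X \<subseteq> pverts G \<and>
     pairwise (positionable G X) X \<and>
     pairwise (positionable G X) (pverts G - X)"

text \<open>For a finite graph this is the maximum of a finite set of numbers containing 0, since the
  empty set is always a dual general position set.\<close>

definition gp_d :: "'a pair_pre_digraph \<Rightarrow> nat" where
  "gp_d G = Max {card X | X. dual_gp_set G X}"

definition lex_product ::
  "'a pair_pre_digraph \<Rightarrow> 'b pair_pre_digraph \<Rightarrow> ('a \<times> 'b) pair_pre_digraph" where
  "lex_product G H = \<lparr>
     pverts = pverts G \<times> pverts H,
     parcs = {((g, h), (g', h')) | g h g' h'.
       (g, h) \<in> pverts G \<times> pverts H \<and> (g', h') \<in> pverts G \<times> pverts H \<and>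
       ((g, g') \<in> parcs G \<or> g = g' \<and> (h, h') \<in> parcs H)} \<rparr>"

lemma pair_graph_lex_product:
  assumes "pair_graph G" "pair_graph H"
  shows "pair_graph (lex_product G H)"
proof -
  interpret G: pair_graph G by fact
  interpret H: pair_graph H by fact
  have G_sym: "(v, u) \<in> parcs G" if "(u, v) \<in> parcs G" for u v
    using G.sym_arcs that by (auto simp: symmetric_def dest: symD)
  have H_sym: "(v, u) \<in> parcs H" if "(u, v) \<in> parcs H" for u v
    using H.sym_arcs that by (auto simp: symmetric_def dest: symD)
  show ?thesis
  proof
    have "parcs (lex_product G H) \<subseteq> (pverts G \<times> pverts H) \<times> (pverts G \<times> pverts H)"
      by (auto simp: lex_product_def)
    then show "finite (parcs (lex_product G H))"
      by (rule finite_subset) simp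
  qed (auto simp: lex_product_def symmetric_def intro!: symI
        dest: G_sym H_sym G.pair_no_loops H.pair_no_loops)
qed

lemma simplicial_iff_pairwise:
  assumes "pair_graph G"
  shows "simplicial G v \<longleftrightarrow>
    v \<in> pverts G \<and> pairwise (\<lambda>u w. (u, w) \<in> parcs G) (neighbourhood G v)"
proof -
  interpret pair_graph G by fact
  let ?N = "neighbourhood G v"
  let ?I = "\<lparr>pverts = ?N, parcs = {e \<in> parcs G. fst e \<in> ?N \<and> snd e \<in> ?N}\<rparr>"
  have fin: "finite ?N"
    by (rule finite_subset[OF _ pair_finite_verts]) (auto simp: neighbourhood_def in_arcsD2)
  have "induce_subgraph (with_proj G) ?N = with_proj ?I"
    by (simp add: induce_subgraph_def with_proj_def)
  then have "complete_digraph (card ?N) (induce_subgraph (with_proj G) ?N) \<longleftrightarrow>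
      parcs ?I = {(u, w). (u, w) \<in> ?N \<times> ?N \<and> u \<noteq> w}"
    using fin by (simp only: complete_digraph_pair_def) simp
  also have "\<dots> \<longleftrightarrow> pairwise (\<lambda>u w. (u, w) \<in> parcs G) ?N"
    by (auto simp: pairwise_def dest: pair_no_loops)
  finally show ?thesis
    by (simp add: simplicial_def)
qed

lemma finite_dual_gp_cards:
  assumes "pair_graph G"
  shows "finite {card X | X. dual_gp_set G X}" "0 \<in> {card X | X. dual_gp_set G X}"
proof -
  interpret pair_graph G by fact
  have "{card X | X. dual_gp_set G X} \<subseteq> card ` Pow (pverts G)"
    by (auto simp: dual_gp_set_def)
  then show "finite {card X | X. dual_gp_set G X}"
    by (rule finite_subset) simp
  have "dual_gp_set G {}"
    by (simp add: dual_gp_set_def positionable_def pairwise_def)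
  then show "0 \<in> {card X | X. dual_gp_set G X}"
    by force
qed

end

theory Submission
  imports Defs
begin

text \<open>
  (i) If \<open>(g, h)\<close> lies in a dual general position set \<open>X\<close>, then \<open>g\<close> is the middle vertex of an
  induced path \<open>g\<^sub>1, g, g\<^sub>2\<close>, and every path \<open>(g\<^sub>1, a), (g, h), (g\<^sub>2, b)\<close> is shortest, so exactly
  one of its ends lies in \<open>X\<close>. Hence one of the two fibres over \<open>g\<^sub>1\<close> and \<open>g\<^sub>2\<close> lies entirely in
  \<open>X\<close>, which is impossible because that fibre contains an induced path on three vertices.

  (ii) Shortest paths between different fibres of \<open>G \<circ> K\<^sub>n\<close> are exactly the lifts of shortest paths
  of \<open>G\<close>, and two vertices of the same fibre are adjacent. Therefore \<open>X \<times> V(K\<^sub>n)\<close> is a dual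
  general position set whenever \<open>X\<close> is one, and the projection to \<open>G\<close> of a dual general position
  set of the product is one as well.
\<close>

section \<open>Walks and shortest paths\<close>

lemma vwalk_with_proj_iff:
  "vwalk p (with_proj G) \<longleftrightarrow>
    p \<noteq> [] \<and> set p \<subseteq> pverts G \<and> successively (\<lambda>x y. (x, y) \<in> parcs G) p"
proof -
  have "set (vwalk_arcs p) \<subseteq> parcs G \<longleftrightarrow> successively (\<lambda>x y. (x, y) \<in> parcs G) p"
    by (induction p rule: vwalk_arcs.induct) auto
  then show ?thesis
    by (auto simp: vwalk_def)
qed

lemma path_between_iff:
  "path_between G u p v \<longleftrightarrow>
    p \<noteq> [] \<and> set p \<subseteq> pverts G \<and> successively (\<lambda>x y. (x, y) \<in> parcs G) p \<and>
    distinct p \<and> hd p = u \<and> last p = v"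
  by (auto simp: path_between_def vpath_def vwalk_with_proj_iff)

text \<open>A path is a nonempty list with one more vertex than arcs, so comparing list lengths
  gives the same order as \<open>vwalk_length\<close> and avoids truncated subtraction.\<close>

lemma shortest_path_iff_length:
  "shortest_path G u p v \<longleftrightarrow>
    path_between G u p v \<and> (\<forall>q. path_between G u q v \<longrightarrow> length p \<le> length q)"
proof -
  have "length p - 1 \<le> length q - 1 \<longleftrightarrow> length p \<le> length q"
    if "path_between G u p v" "path_between G u q v" for q
    using that by (cases p; cases q) (auto simp: path_between_iff)
  then show ?thesis
    by (auto simp: shortest_path_def)
qed

lemma path_between_vwalk_to_vpath:
  assumes "vwalk p (with_proj G)"
  shows "path_between G (hd p) (vwalk_to_vpath p) (last p)"
  using vwalk_to_vpath_vpath[OF assms]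
  by (simp add: path_between_def vwalk_to_vpath_hd vwalk_to_vpath_last)

lemma shortest_path_common_neighbour:
  assumes "pair_graph G" "(u, w) \<in> parcs G" "(w, v) \<in> parcs G" "u \<noteq> v" "(u, v) \<notin> parcs G"
  shows "shortest_path G u [u, w, v] v"
proof -
  interpret pair_graph G by fact
  have "path_between G u [u, w, v] v"
    using assms by (auto simp: path_between_iff dest: pair_no_loops intro: in_arcsD1 in_arcsD2)
  moreover have "3 \<le> length q" if "path_between G u q v" for q
    \<comment> \<open>The case splits leave lists with at most two entries, which
      \<open>u \<noteq> v\<close> and \<open>(u, v) \<notin> parcs G\<close> exclude.\<close>
    using that assms by (cases q rule: vwalk_arcs.cases; cases "tl (tl q)")
      (auto simp: path_between_iff)
  ultimately show ?thesis
    by (simp add: shortest_path_iff_length numeral_3_eq_3)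
qed

text \<open>The competitor \<open>[u, v]\<close> leaves no room for an internal vertex. This settles
  pairs inside one fibre of a product with a complete graph.\<close>

lemma shortest_path_adjacent:
  assumes "shortest_path G u p v" "u \<in> pverts G" "v \<in> pverts G" "(u, v) \<in> parcs G" "u \<noteq> v"
  shows "set p \<subseteq> {u, v}"
proof -
  have "path_between G u [u, v] v"
    using assms by (auto simp: path_between_iff)
  then have "length p \<le> 2" "path_between G u p v"
    using assms by (auto simp: shortest_path_iff_length)
  then show ?thesis
    by (cases p rule: vwalk_arcs.cases) (auto simp: path_between_iff)
qed


section \<open>Dual general position sets\<close>

lemma dual_gp_set_iff:
  "dual_gp_set G X \<longleftrightarrow> X \<subseteq> pverts G \<and>
    (\<forall>u\<in>pverts G. \<forall>v\<in>pverts G. u \<noteq> v \<longrightarrow> (u \<in> X \<longleftrightarrow> v \<in> X) \<longrightarrow> positionable G X u v)"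
  by (auto simp: dual_gp_set_def pairwise_def)

text \<open>The shortest path \<open>[u, w, v]\<close> has its internal vertex in \<open>X\<close>,
  so \<open>u\<close> and \<open>v\<close> cannot lie on the same side of \<open>X\<close>.\<close>

lemma dual_gp_set_common_neighbour:
  assumes "pair_graph G" "dual_gp_set G X" "w \<in> X"
    and "(u, w) \<in> parcs G" "(w, v) \<in> parcs G" "u \<noteq> v" "(u, v) \<notin> parcs G"
  shows "u \<in> X \<longleftrightarrow> v \<notin> X"
proof -
  interpret pair_graph G by fact
  have "\<not> positionable G X u v"
    unfolding positionable_def not_not
  proof (intro exI conjI bexI)
    show "shortest_path G u [u, w, v] v"
      using assms by (intro shortest_path_common_neighbour)
    show "w \<in> set [u, w, v] - {u, v}"
      using assms by (auto dest: pair_no_loops)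
  qed fact
  moreover have "u \<in> pverts G" "v \<in> pverts G"
    using assms by (auto intro: in_arcsD1 in_arcsD2)
  ultimately show ?thesis
    using assms by (auto simp: dual_gp_set_iff)
qed

lemma not_simplicialE:
  assumes "pair_graph G" "\<not> simplicial G v" "v \<in> pverts G"
  obtains u w where "(u, v) \<in> parcs G" "(v, w) \<in> parcs G" "u \<noteq> w" "(u, w) \<notin> parcs G"
proof -
  interpret pair_graph G by fact
  have "(v, u) \<in> parcs G \<Longrightarrow> (u, v) \<in> parcs G" for u
    using sym_arcs by (auto simp: symmetric_def dest: symD)
  then show ?thesis
    using assms that
    by (auto simp: simplicial_iff_pairwise pairwise_def neighbourhood_def)
qed

lemma card_le_gp_d:
  assumes "pair_graph G" "dual_gp_set G X"
  shows "card X \<le> gp_d G"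
  unfolding gp_d_def using assms by (intro Max_ge finite_dual_gp_cards) auto

lemma gp_d_attained:
  assumes "pair_graph G"
  obtains X where "dual_gp_set G X" "card X = gp_d G"
proof -
  have "gp_d G \<in> {card X | X. dual_gp_set G X}"
    unfolding gp_d_def using finite_dual_gp_cards[OF assms] by (intro Max_in) auto
  then show ?thesis
    using that by auto
qed


section \<open>Lexicographic products\<close>

lemma pverts_lex_product [simp]: "pverts (lex_product G H) = pverts G \<times> pverts H"
  by (simp add: lex_product_def)

lemma parcs_lex_product_iff:
  "((g, h), (g', h')) \<in> parcs (lex_product G H) \<longleftrightarrow>
    g \<in> pverts G \<and> g' \<in> pverts G \<and> h \<in> pverts H \<and> h' \<in> pverts H \<and>
    ((g, g') \<in> parcs G \<or> g = g' \<and> (h, h') \<in> parcs H)"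
  by (auto simp: lex_product_def)

text \<open>Steps inside a fibre become repetitions in the projected walk.\<close>

lemma vwalk_project:
  assumes "vwalk p (with_proj (lex_product G H))"
  shows "vwalk (remdups_adj (map fst p)) (with_proj G)"
proof -
  have "successively (\<lambda>x y. (x, y) \<in> parcs (lex_product G H)) p" "p \<noteq> []"
    "set p \<subseteq> pverts G \<times> pverts H"
    using assms by (auto simp: vwalk_with_proj_iff)
  moreover from this(1) have "successively (\<lambda>x y. (x, y) \<in> parcs G) (remdups_adj (map fst p))"
  proof (induction p rule: vwalk_arcs.induct)
    case (3 x y p)
    then show ?case
      by (cases x; cases y)
        (auto simp: parcs_lex_product_iff successively_Cons simp del: remdups_adj_Cons_alt)
  qed auto
  ultimately show ?thesis
    by (fastforce simp: vwalk_with_proj_iff)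
qed

text \<open>Dropping repetitions and cycles can only shorten the projection. If nothing is lost, the
  first coordinates in \<open>p\<close> are distinct and the projection itself is a path; the last
  clause records this equality case.\<close>

lemma path_project:
  assumes "path_between (lex_product G H) (g, h) p (g', h')"
  obtains q where "path_between G g q g'" "length q \<le> length p"
    "length q = length p \<longrightarrow> path_between G g (map fst p) g'"
proof -
  let ?r = "remdups_adj (map fst p)"
  define q where "q = vwalk_to_vpath ?r"
  have p: "p \<noteq> []" "hd p = (g, h)" "last p = (g', h')"
    and walk: "vwalk ?r (with_proj G)"
    using assms vwalk_project[of p G H] by (auto simp: path_between_def vpath_def vwalk_def)
  have path: "path_between G g q g'"
    using path_between_vwalk_to_vpath[OF walk] p by (simp add: q_def hd_map last_map)
  have "length q = card (set q)"
    using path by (simp add: path_between_iff distinct_card)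
  also have "\<dots> \<le> card (set (map fst p))"
  proof (rule card_mono)
    show "set q \<subseteq> set (map fst p)"
      using vwalk_to_vpath_subset[of _ ?r] unfolding q_def remdups_adj_set by blast
  qed simp
  finally have len: "length q \<le> card (set (map fst p))" .
  show thesis
  proof
    show "path_between G g q g'" by fact
    show "length q \<le> length p"
      using len card_length[of "map fst p"] by simp
    show "length q = length p \<longrightarrow> path_between G g (map fst p) g'"
    proof
      assume "length q = length p"
      then have "distinct (map fst p)"
        using len card_length[of "map fst p"] by (intro card_distinct) simp
      then show "path_between G g (map fst p) g'"
        using walk p
        by (simp add: path_between_def vpath_def hd_map last_map remdups_adj_distinct)
    qed
  qed
qed

text \<open>An arc of \<open>G\<close> joins all vertices of the two fibres, so \<open>f\<close> is
  arbitrary; this freedom lets a lift pass through prescribed vertices.\<close>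

lemma path_lift:
  assumes "path_between G g p g'" "f \<in> pverts G \<rightarrow> pverts H"
  shows "path_between (lex_product G H) (g, f g) (map (\<lambda>x. (x, f x)) p) (g', f g')"
proof -
  have "set p \<subseteq> pverts G" and "successively (\<lambda>x y. (x, y) \<in> parcs G) p"
    using assms by (auto simp: path_between_iff)
  from this(2) have "successively (\<lambda>x y. (x, y) \<in> parcs (lex_product G H)) (map (\<lambda>x. (x, f x)) p)"
    unfolding successively_map
    by (rule successively_mono) (use assms \<open>set p \<subseteq> pverts G\<close> in \<open>auto simp: parcs_lex_product_iff\<close>)
  then show ?thesis
    using assms by (auto simp: path_between_iff hd_map last_map distinct_map inj_on_def)
qed

lemma shortest_path_lift:
  assumes "shortest_path G g p g'" "f \<in> pverts G \<rightarrow> pverts H"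
  shows "shortest_path (lex_product G H) (g, f g) (map (\<lambda>x. (x, f x)) p) (g', f g')"
  unfolding shortest_path_iff_length
proof (intro conjI allI impI)
  show "path_between (lex_product G H) (g, f g) (map (\<lambda>x. (x, f x)) p) (g', f g')"
    using assms by (intro path_lift) (auto simp: shortest_path_def)
  fix q assume "path_between (lex_product G H) (g, f g) q (g', f g')"
  then obtain r where "path_between G g r g'" "length r \<le> length q"
    by (rule path_project)
  then show "length (map (\<lambda>x. (x, f x)) p) \<le> length q"
    using assms by (force simp: shortest_path_iff_length)
qed

lemma shortest_path_project:
  assumes "shortest_path (lex_product G H) (g, h) p (g', h')" "g \<noteq> g'"
  shows "shortest_path G g (map fst p) g'"
proof -
  have p: "path_between (lex_product G H) (g, h) p (g', h')"
    using assms by (simp add: shortest_path_def)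
  then have "h \<in> pverts H" "h' \<in> pverts H"
    by (auto simp: path_between_iff dest: hd_in_set last_in_set)
  \<comment> \<open>Since \<open>g \<noteq> g'\<close>, the updated function takes the value
    \<open>h\<close> at \<open>g\<close> and \<open>h'\<close> at \<open>g'\<close>, so the lift of
    \<open>q\<close> joins the ends of \<open>p\<close>.\<close>
  then have le: "length p \<le> length q" if "path_between G g q g'" for q
    using path_lift[OF that, of "(\<lambda>_. h')(g := h)" H] assms
    by (auto simp: shortest_path_iff_length)
  obtain q where q: "path_between G g q g'" "length q \<le> length p"
    "length q = length p \<longrightarrow> path_between G g (map fst p) g'"
    using p by (rule path_project)
  then have "path_between G g (map fst p) g'"
    using le[OF q(1)] by simp
  then show ?thesis
    using le by (simp add: shortest_path_iff_length)
qed

section \<open>Positionability across different fibres\<close>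

lemma positionable_project:
  assumes "positionable (lex_product G H) X (g, h) (g', h')" "g \<noteq> g'"
    and "h \<in> pverts H" "h' \<in> pverts H" "X \<subseteq> pverts (lex_product G H)"
  shows "positionable G (fst ` X) g g'"
  unfolding positionable_def
proof
  assume "\<exists>p. shortest_path G g p g' \<and> (\<exists>w\<in>set p - {g, g'}. w \<in> fst ` X)"
  then obtain p w where p: "shortest_path G g p g'" "w \<in> set p" "w \<noteq> g" "w \<noteq> g'"
    and "w \<in> fst ` X"
    by blast
  then obtain k where k: "(w, k) \<in> X"
    by auto
  \<comment> \<open>The lift keeps the given ends and meets the fibre over \<open>w\<close> in the
    vertex of \<open>X\<close>; the three values are compatible because \<open>g\<close>,
    \<open>g'\<close> and \<open>w\<close> are distinct.\<close>
  define f where "f = (\<lambda>_. h)(g' := h', w := k)"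
  have "f \<in> pverts G \<rightarrow> pverts H"
    using assms k by (auto simp: f_def)
  from shortest_path_lift[OF p(1) this]
  have "shortest_path (lex_product G H) (g, h) (map (\<lambda>x. (x, f x)) p) (g', h')"
    using p assms by (simp add: f_def)
  moreover have "(w, k) \<in> set (map (\<lambda>x. (x, f x)) p) - {(g, h), (g', h')}"
    using p by (auto simp: f_def)
  ultimately show False
    using assms k by (auto simp: positionable_def)
qed

lemma positionable_lift:
  assumes "positionable G X g g'" "g \<noteq> g'"
  shows "positionable (lex_product G H) (X \<times> B) (g, h) (g', h')"
  unfolding positionable_def
proof
  assume "\<exists>p. shortest_path (lex_product G H) (g, h) p (g', h') \<and>
    (\<exists>x\<in>set p - {(g, h), (g', h')}. x \<in> X \<times> B)"
  then obtain p w k where p: "shortest_path (lex_product G H) (g, h) p (g', h')"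
    and w: "(w, k) \<in> set p" "(w, k) \<noteq> (g, h)" "(w, k) \<noteq> (g', h')" "w \<in> X"
    by auto
  have path: "shortest_path G g (map fst p) g'"
    using p assms by (intro shortest_path_project)
  \<comment> \<open>The path meets each fibre at most once, so its internal vertices avoid the
    fibres of its ends.\<close>
  then have "inj_on fst (set p)"
    by (simp add: shortest_path_def path_between_iff distinct_map)
  moreover have "(g, h) \<in> set p" "(g', h') \<in> set p"
    using p by (auto simp: shortest_path_def path_between_iff dest: hd_in_set last_in_set)
  ultimately have "w \<noteq> g" "w \<noteq> g'"
    using w by (metis fst_conv inj_onD)+
  then have "w \<in> set (map fst p) - {g, g'}"
    using w by force
  then show False
    using assms path w unfolding positionable_def by blast
qed

section \<open>Factors without simplicial vertices\<close>

lemma dual_gp_set_lex_product_empty: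
  assumes "pair_graph G" "pair_graph H" "\<nexists>v. simplicial G v" "\<nexists>v. simplicial H v"
    and "dual_gp_set (lex_product G H) X"
  shows "X = {}"
proof (rule ccontr)
  interpret G: pair_graph G by fact
  interpret H: pair_graph H by fact
  note common = dual_gp_set_common_neighbour[OF pair_graph_lex_product[OF assms(1,2)] assms(5)]
  assume "X \<noteq> {}"
  then obtain g h where gh: "(g, h) \<in> X"
    by auto
  then have V: "g \<in> pverts G" "h \<in> pverts H"
    using assms by (auto simp: dual_gp_set_def)
  obtain g1 g2 where g: "(g1, g) \<in> parcs G" "(g, g2) \<in> parcs G" "g1 \<noteq> g2" "(g1, g2) \<notin> parcs G"
    using assms(1,3) V not_simplicialE[of G g] by blast
  obtain h1 h2 where h: "(h1, h) \<in> parcs H" "(h, h2) \<in> parcs H" "h1 \<noteq> h2" "(h1, h2) \<notin> parcs H"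
    using assms(2,4) V not_simplicialE[of H h] by blast
  have gV: "g1 \<in> pverts G" "g2 \<in> pverts G" and hV: "h1 \<in> pverts H" "h2 \<in> pverts H"
    using g h by (auto dest: G.in_arcsD1 G.in_arcsD2 H.in_arcsD1 H.in_arcsD2)
  have sides: "(g1, a) \<in> X \<longleftrightarrow> (g2, b) \<notin> X" if "a \<in> pverts H" "b \<in> pverts H" for a b
    using g gV V that by (intro common[OF gh]) (auto simp: parcs_lex_product_iff)
  have fibre: "\<not> {x} \<times> pverts H \<subseteq> X" if "x \<in> pverts G" for x
  proof
    assume "{x} \<times> pverts H \<subseteq> X"
    then have "(x, h) \<in> X" "(x, h1) \<in> X" "(x, h2) \<in> X"
      using V hV by auto
    moreover have "(x, h1) \<in> X \<longleftrightarrow> (x, h2) \<notin> X"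
      using h hV V that
      \<comment> \<open>Here \<open>(x, h)\<close> is the middle vertex of the copy of
        \<open>h1\<close>, \<open>h\<close>, \<open>h2\<close>; since \<open>x\<close> carries no
        loop, the ends stay nonadjacent.\<close>
      by (intro common[OF \<open>(x, h) \<in> X\<close>])
        (auto simp: parcs_lex_product_iff dest: G.pair_no_loops)
    ultimately show False by simp
  qed
  show False
    \<comment> \<open>If some \<open>(g1, a)\<close> is missing from \<open>X\<close>, then
      \<open>sides\<close> puts the whole fibre over \<open>g2\<close> into
      \<open>X\<close>.\<close>
    using fibre[OF gV(1)] fibre[OF gV(2)] sides hV by auto
qed

section \<open>Products with a complete graph\<close>

lemma dual_gp_set_lex_product_complete:
  assumes "dual_gp_set G X" "complete_digraph n (with_proj K)"
  shows "dual_gp_set (lex_product G K) (X \<times> pverts K)"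
  unfolding dual_gp_set_iff
proof (intro conjI ballI impI)
  show "X \<times> pverts K \<subseteq> pverts (lex_product G K)"
    using assms by (auto simp: dual_gp_set_def)
  fix u v
  assume uv: "u \<in> pverts (lex_product G K)" "v \<in> pverts (lex_product G K)" "u \<noteq> v"
    "(u \<in> X \<times> pverts K) = (v \<in> X \<times> pverts K)"
  obtain g h g' h' where [simp]: "u = (g, h)" "v = (g', h')"
    by (cases u; cases v)
  show "positionable (lex_product G K) (X \<times> pverts K) u v"
  proof (cases "g = g'")
    case True
    then have "(u, v) \<in> parcs (lex_product G K)"
      using uv assms(2) by (auto simp: parcs_lex_product_iff complete_digraph_pair_def)
    then show ?thesis
      using uv by (auto simp: positionable_def dest: shortest_path_adjacent)
  next
    case False
    then show ?thesis
      using uv assms(1) by (auto simp: dual_gp_set_iff intro!: positionable_lift)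
  qed
qed

lemma dual_gp_set_project:
  assumes "dual_gp_set (lex_product G H) X" "pverts H \<noteq> {}"
  shows "dual_gp_set G (fst ` X)"
  unfolding dual_gp_set_iff
proof (intro conjI ballI impI)
  have X: "X \<subseteq> pverts (lex_product G H)"
    using assms by (simp add: dual_gp_set_def)
  then show "fst ` X \<subseteq> pverts G"
    by auto
  fix u v
  assume uv: "u \<in> pverts G" "v \<in> pverts G" "u \<noteq> v" "u \<in> fst ` X \<longleftrightarrow> v \<in> fst ` X"
  \<comment> \<open>Representatives on the same side of \<open>X\<close> are needed: members of
    \<open>X\<close> if both fibres meet it, otherwise any vertices, as both fibres then miss
    \<open>X\<close>.\<close>
  obtain a b where "a \<in> pverts H" "b \<in> pverts H" "(u, a) \<in> X \<longleftrightarrow> (v, b) \<in> X"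
  proof (cases "u \<in> fst ` X")
    case True
    then obtain a b where "(u, a) \<in> X" "(v, b) \<in> X"
      using uv by force
    then show ?thesis
      using X that by auto
  next
    case False
    then have "(u, a) \<notin> X" "(v, a) \<notin> X" for a
      using uv by force+
    then show ?thesis
      using assms that by blast
  qed
  then show "positionable G (fst ` X) u v"
    using assms X uv by (intro positionable_project[of G H X u a v b]) (auto simp: dual_gp_set_iff)
qed

lemma gp_d_lex_product_complete:
  assumes "pair_graph G" "complete_digraph n (with_proj K)" "n \<ge> 1"
  shows "gp_d (lex_product G K) = n * gp_d G"
proof (rule antisym)
  have K: "pair_graph K" and fin: "finite (pverts K)" and card: "card (pverts K) = n"
    using assms by (auto simp: complete_digraph_pair_def intro: pair_graphI_complete)
  then have ne: "pverts K \<noteq> {}"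
    using assms by auto
  have lex: "pair_graph (lex_product G K)"
    using assms K by (intro pair_graph_lex_product)
  interpret G: pair_graph G by fact
  show "gp_d (lex_product G K) \<le> n * gp_d G"
  proof -
    obtain X where X: "dual_gp_set (lex_product G K) X" "card X = gp_d (lex_product G K)"
      using gp_d_attained[OF lex] .
    have proj: "dual_gp_set G (fst ` X)"
      using X ne by (intro dual_gp_set_project)
    then have "finite (fst ` X)"
      using finite_subset[OF _ G.pair_finite_verts] by (simp add: dual_gp_set_def)
    \<comment> \<open>Each vertex of the projection accounts for at most \<open>n\<close> elements
      of \<open>X\<close>.\<close>
    moreover have "X \<subseteq> fst ` X \<times> pverts K"
      using X by (force simp: dual_gp_set_def)
    ultimately have "card X \<le> card (fst ` X \<times> pverts K)"
      using fin by (intro card_mono) auto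
    also have "\<dots> \<le> n * gp_d G"
      using card_le_gp_d[OF assms(1) proj] card by (simp add: card_cartesian_product)
    finally show ?thesis
      using X by simp
  qed
  obtain X where "dual_gp_set G X" "card X = gp_d G"
    using gp_d_attained[OF assms(1)] .
  then show "n * gp_d G \<le> gp_d (lex_product G K)"
    using card_le_gp_d[OF lex dual_gp_set_lex_product_complete[OF _ assms(2)]] card
    by (metis card_cartesian_product mult.commute)
qed

theorem theorem5p9:
  fixes G :: "'a pair_pre_digraph"
  assumes "pair_graph G"
    and "connected (with_proj G)"
  shows
    "(\<forall>H :: 'b pair_pre_digraph.
        (\<nexists>v. simplicial G v) \<and>
        pair_graph H \<and> connected (with_proj H) \<and> (\<nexists>v. simplicial H v) \<longrightarrow>
        gp_d (lex_product G H) = 0) \<and>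
     (\<forall>(n::nat) (K :: 'c pair_pre_digraph).
        n \<ge> 1 \<and> complete_digraph n (with_proj K) \<longrightarrow>
        gp_d (lex_product G K) = n * gp_d G)"
proof (intro conjI allI impI; elim conjE)
  fix H :: "'b pair_pre_digraph"
  assume H: "pair_graph H" "\<nexists>v. simplicial G v" "\<nexists>v. simplicial H v"
  obtain X where "dual_gp_set (lex_product G H) X" "card X = gp_d (lex_product G H)"
    using gp_d_attained[OF pair_graph_lex_product[OF assms(1) H(1)]] .
  then show "gp_d (lex_product G H) = 0"
    using dual_gp_set_lex_product_empty[OF assms(1) H, of X] by simp
next
  fix n :: nat and K :: "'c pair_pre_digraph"
  assume "n \<ge> 1" "complete_digraph n (with_proj K)"
  then show "gp_d (lex_product G K) = n * gp_d G"
    using gp_d_lex_product_complete[OF assms(1)] by blast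
qed

end
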